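(* Let $L$ be a complete multiplicative lattice. For $x,y\in L$, we have: (a) if $L$ satisfies the weak monotonicity condition and $x$ is $y$-solvable, then $x$ is locally $y$-solvable; (b) if $L$ satisfies the weak Kaplansky condition and $x$ is compact and locally $y$-solvable, then $x$ is $y$-solvable; (c) if $L$ is algebraic and satisfies the weak monotonicity condition and the weak Kaplansky condition, then $\mathrm{loc.solv}(y)=\mathrm{solv}(y)$ for all $y\in L$.
   Context: A complete multiplicative lattice is a complete lattice $L$ (smallest element $0$, largest element $1$) equipped with a binary multiplication satisfying $xy\leqslant x\wedge y$ for all $x,y\in L$; nothing else is assumed about the multiplication. Write $x^2=xx$. For $x\in L$ the derived series is $x^{(0)}=x$, $x^{(n+1)}=(x^{(n)})^2$. For $y\in L$, $x$ is $y$-solvable if $x^{(n)}\leqslant y$ for some natural $n$; $\mathrm{solv}(y)$ is the join of all $y$-solvable elements of $L$. An element $x$ of a complete lattice is compact if every subset $S$ with $x\leqslant\bigvee S$ has a finite subset $F$ with $x\leqslant\bigvee F$; the lattice is algebraic if every element is a join of compact elements. $x$ is locally $y$-solvable if, for every infinite sequence $c_0,c_1,c_2,\ldots$ of compact elements of $L$ with $c_0\leqslant x$ and $c_{n+1}\leqslant c_n^2$ for all $n=0,1,2,\ldots$, there exists $n$ with $c_n\leqslant y$; $\mathrm{loc.solv}(y)$ is the join of all locally $y$-solvable elements of $L$. Weak monotonicity condition: $x\leqslant y\Rightarrow x^2\leqslant y^2$ for all $x,y\in L$. Weak Kaplansky condition: whenever $x\in L$ is compact, so is $x^2$. *)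

theory Defs
  imports Main
begin

text \<open>The smallest and largest elements are \<^const>\<open>bot\<close> and \<^const>\<open>top\<close>. The multiplication is
  not assumed to be associative, commutative, unital or monotone.\<close>

class complete_multiplicative_lattice = complete_lattice + times +
  assumes mult_le_inf: "x * y \<le> inf x y"

primrec derived :: "'a::complete_multiplicative_lattice \<Rightarrow> nat \<Rightarrow> 'a" where
  "derived x 0 = x"
| "derived x (Suc n) = derived x n * derived x n"

definition solvable :: "'a::complete_multiplicative_lattice \<Rightarrow> 'a \<Rightarrow> bool" where
  "solvable y x \<longleftrightarrow> (\<exists>n. derived x n \<le> y)"

definition solv :: "'a::complete_multiplicative_lattice \<Rightarrow> 'a" where
  "solv y = Sup {x. solvable y x}"

definition compact_element :: "'a::complete_lattice \<Rightarrow> bool" where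
  "compact_element x \<longleftrightarrow> (\<forall>S. x \<le> Sup S \<longrightarrow> (\<exists>F. finite F \<and> F \<subseteq> S \<and> x \<le> Sup F))"

text \<open>The \<^typ>\<open>'a itself\<close> arguments below only name the lattice, as in \<^term>\<open>TYPE('a)\<close>.\<close>

definition algebraic_lattice :: "'a::complete_lattice itself \<Rightarrow> bool" where
  "algebraic_lattice _ \<longleftrightarrow> (\<forall>x::'a. \<exists>C. (\<forall>c\<in>C. compact_element c) \<and> x = Sup C)"

definition locally_solvable :: "'a::complete_multiplicative_lattice \<Rightarrow> 'a \<Rightarrow> bool" where
  "locally_solvable y x \<longleftrightarrow>
    (\<forall>c :: nat \<Rightarrow> 'a.
      (\<forall>n. compact_element (c n)) \<and> c 0 \<le> x \<and> (\<forall>n. c (Suc n) \<le> c n * c n)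
      \<longrightarrow> (\<exists>n. c n \<le> y))"

definition loc_solv :: "'a::complete_multiplicative_lattice \<Rightarrow> 'a" where
  "loc_solv y = Sup {x. locally_solvable y x}"

definition weak_monotonicity :: "'a::complete_multiplicative_lattice itself \<Rightarrow> bool" where
  "weak_monotonicity _ \<longleftrightarrow> (\<forall>x y :: 'a. x \<le> y \<longrightarrow> x * x \<le> y * y)"

definition weak_Kaplansky :: "'a::complete_multiplicative_lattice itself \<Rightarrow> bool" where
  "weak_Kaplansky _ \<longleftrightarrow> (\<forall>x :: 'a. compact_element x \<longrightarrow> compact_element (x * x))"

end

theory Submission
  imports Defs
begin

text \<open>The derived series of \<open>x\<close> is the extremal case of the sequences that test
  local solvability. Under weak monotonicity it dominates every such sequence starting below
  \<open>x\<close> (\<open>le_derived\<close>), so once it falls below \<open>y\<close>, they all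
  do. Under weak Kaplansky and for compact \<open>x\<close> it is itself such a sequence
  (\<open>compact_derived\<close>), so local solvability forces it below \<open>y\<close>. In an
  algebraic lattice this second fact is applied to compact elements whose join is a given locally
  solvable element.\<close>

lemma compact_derived:
  fixes x :: "'a::complete_multiplicative_lattice"
  assumes "weak_Kaplansky TYPE('a)" and "compact_element x"
  shows "compact_element (derived x n)"
  using assms by (induction n) (auto simp: weak_Kaplansky_def)

text \<open>Weak monotonicity lets both sides of the inequality at stage \<open>n\<close> be
  squared, and \<open>c (Suc n)\<close> lies below the smaller square.\<close>

lemma le_derived:
  fixes c :: "nat \<Rightarrow> 'a::complete_multiplicative_lattice"
  assumes mono: "weak_monotonicity TYPE('a)"
    and c0: "c 0 \<le> x" and step: "\<And>n. c (Suc n) \<le> c n * c n"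
  shows "c n \<le> derived x n"
proof (induction n)
  case 0
  show ?case using c0 by simp
next
  case (Suc n)
  then have "c n * c n \<le> derived x n * derived x n"
    using mono unfolding weak_monotonicity_def by blast
  then show ?case using step[of n] by (simp add: order_trans)
qed

lemma solvable_imp_locally_solvable:
  fixes x y :: "'a::complete_multiplicative_lattice"
  assumes "weak_monotonicity TYPE('a)" and "solvable y x"
  shows "locally_solvable y x"
  unfolding locally_solvable_def
proof (intro allI impI, elim conjE)
  fix c :: "nat \<Rightarrow> 'a"
  assume "c 0 \<le> x" and "\<forall>n. c (Suc n) \<le> c n * c n"
  then have "c n \<le> derived x n" for n
    using le_derived[OF assms(1)] by blast
  moreover obtain n where "derived x n \<le> y"
    using assms(2) unfolding solvable_def by blast
  ultimately show "\<exists>n. c n \<le> y"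
    using order_trans by blast
qed

lemma compact_locally_solvable_imp_solvable:
  fixes x y :: "'a::complete_multiplicative_lattice"
  assumes "weak_Kaplansky TYPE('a)" and "compact_element x" and "locally_solvable y x"
  shows "solvable y x"
  \<comment> \<open>The derived series starts at \<open>x\<close> and satisfies the squaring
    condition with equality.\<close>
  using assms(3)[unfolded locally_solvable_def, rule_format, of "derived x"]
    compact_derived[OF assms(1,2)]
  by (simp add: solvable_def)

text \<open>A sequence starting below \<open>x'\<close> also starts below \<open>x\<close>. This
  passes local solvability down to compact elements below \<open>x\<close>.\<close>

lemma locally_solvable_antimono:
  assumes "locally_solvable y x" and "x' \<le> x"
  shows "locally_solvable y x'"
  using assms unfolding locally_solvable_def by (meson order_trans)

lemma loc_solv_eq_solv:
  fixes y :: "'a::complete_multiplicative_lattice"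
  assumes alg: "algebraic_lattice TYPE('a)" and mono: "weak_monotonicity TYPE('a)"
    and kap: "weak_Kaplansky TYPE('a)"
  shows "loc_solv y = solv y"
proof (rule antisym)
  show "solv y \<le> loc_solv y"
    unfolding solv_def loc_solv_def
    using solvable_imp_locally_solvable[OF mono] by (intro Sup_subset_mono) blast
  show "loc_solv y \<le> solv y"
    unfolding loc_solv_def
  proof (rule Sup_least)
    fix x assume "x \<in> {x. locally_solvable y x}"
    then have x: "locally_solvable y x" by simp
    obtain C where C: "\<forall>c\<in>C. compact_element c" "x = Sup C"
      using alg unfolding algebraic_lattice_def by blast
    \<comment> \<open>Since \<open>x\<close> itself may fail to be compact, solvability is obtained
      only for the members of \<open>C\<close>; bounding each by \<open>solv y\<close> bounds their
      join \<open>x\<close>.\<close>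
    have "c \<le> solv y" if "c \<in> C" for c
    proof -
      have "c \<le> x" using that C(2) by (simp add: Sup_upper)
      then have "solvable y c"
        using compact_locally_solvable_imp_solvable[OF kap] locally_solvable_antimono[OF x]
          C(1) that by blast
      then show ?thesis unfolding solv_def by (simp add: Sup_upper)
    qed
    then show "x \<le> solv y" using C(2) by (simp add: Sup_least)
  qed
qed

theorem theorem6p13:
  fixes x y :: "'a::complete_multiplicative_lattice"
  shows "(weak_monotonicity TYPE('a) \<longrightarrow> solvable y x \<longrightarrow> locally_solvable y x) \<and>
    (weak_Kaplansky TYPE('a) \<longrightarrow> compact_element x \<longrightarrow> locally_solvable y x \<longrightarrow> solvable y x) \<and>
    (algebraic_lattice TYPE('a) \<longrightarrow> weak_monotonicity TYPE('a) \<longrightarrow> weak_Kaplansky TYPE('a)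
      \<longrightarrow> (\<forall>z::'a. loc_solv z = solv z))"
  using solvable_imp_locally_solvable compact_locally_solvable_imp_solvable loc_solv_eq_solv
  by blast

end
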